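(* Let $K$ be a field of characteristic $0$, and let $f,g\in K[t]$ be nonconstant, relatively prime polynomials. Let $w\in K[t]$ be a nonzero polynomial. Consider the equation \[ \bigl(w(f^2-g^2)\bigr)^x + (2wfg)^y = \bigl(w(f^2+g^2)\bigr)^z \] in positive integers $x,y,z$. Then its only positive integer solutions are $(x,y,z)=(2,2,2)$ and $(x,y,z)=(2,1,1)$. Moreover, $(2,1,1)$ is a solution if and only if $w$ is a (nonzero) constant, $w$ has a square root $\sqrt{w}\in K$, and $f=-g+1/\sqrt{w}$ or $f=-g-1/\sqrt{w}$. *)

theory Defs
  imports Complex_Main "HOL-Computational_Algebra.Polynomial"
begin

definition solutions ::
  "'a::field_char_0 poly \<Rightarrow> 'a poly \<Rightarrow> 'a poly \<Rightarrow> (nat \<times> nat \<times> nat) set" where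
  "solutions f g w = {(x, y, z). x > 0 \<and> y > 0 \<and> z > 0 \<and>
     (w * (f\<^sup>2 - g\<^sup>2)) ^ x + (2 * w * f * g) ^ y = (w * (f\<^sup>2 + g\<^sup>2)) ^ z}"

end

(* Put A = f^2 - g^2, B = 2 f g, C = f^2 + g^2. The sought relation
   (w A)^x + (w B)^y - (w C)^z = 0 and the identity A^2 + B^2 - C^2 = 0 carry the same signs, so the
   order of the exponents can be permuted freely, with signs e1, e2, e3. If the minimal exponent is
   attained at two places, a high power of the third polynomial divides a sum of two equal powers,
   hence a small nonzero factor of a Wronskian. Otherwise w divides a power of one of A, B, C, and
   the Mason-Stothers theorem with ABC in place of the radical leaves only exponents 1, 2, z. These are
   excluded by writing the polynomial C with exponent z as a product P Q with deg Q < deg P, and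
   comparing degrees modulo P^3. *)

theory Submission
  imports Defs
begin

section \<open>Bezout identities and coprimality in Euclidean rings\<close>

text \<open>Euclid's algorithm: recursion on the pair \<open>b\<close>, \<open>a mod b\<close>,
  followed by back-substitution of \<open>a mod b = a - (a div b) * b\<close>.\<close>

lemma ex_common_divisor_combination:
  fixes a b :: "'a::euclidean_ring"
  shows "\<exists>d u v. d = u * a + v * b \<and> d dvd a \<and> d dvd b"
proof (induction "euclidean_size b" arbitrary: a b rule: less_induct)
  case less
  show ?case
  proof (cases "b = 0")
    case True
    then show ?thesis by (intro exI[of _ a] exI[of _ 1] exI[of _ 0]) simp
  next
    case False
    from less[OF mod_size_less[OF False], of b a] obtain d u v where
      d: "d = u * b + v * (a mod b)" "d dvd b" "d dvd a mod b" by blast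
    have "d = v * a + (u - v * (a div b)) * b"
      using d(1) by (simp add: algebra_simps minus_div_mult_eq_mod[symmetric])
    moreover have "d dvd a" using d(2,3) by (rule dvd_mod_imp_dvd[rotated])
    ultimately show ?thesis using d(2) by blast
  qed
qed

lemma coprime_iff_combination_eq_one:
  fixes a b :: "'a::euclidean_ring"
  shows "coprime a b \<longleftrightarrow> (\<exists>u v. u * a + v * b = 1)"
proof
  assume ab: "coprime a b"
  obtain d u v where d: "d = u * a + v * b" "d dvd a" "d dvd b"
    using ex_common_divisor_combination by blast
  with ab have "d dvd 1" by (simp add: coprime_common_divisor)
  then obtain k where "1 = d * k" ..
  then have "(k * u) * a + (k * v) * b = 1" using d(1) by (simp add: algebra_simps)
  then show "\<exists>u v. u * a + v * b = 1" by blast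
next
  assume "\<exists>u v. u * a + v * b = 1"
  then obtain u v where uv: "u * a + v * b = 1" by blast
  show "coprime a b"
  proof (rule coprimeI)
    fix d assume "d dvd a" "d dvd b"
    then have "d dvd u * a + v * b" by simp
    then show "d dvd 1" using uv by simp
  qed
qed

lemma coprime_dvd_mult_cancel:
  fixes a b c :: "'a::euclidean_ring"
  assumes "coprime a b" "a dvd b * c"
  shows "a dvd c"
proof -
  obtain u v where "u * a + v * b = 1" using assms(1) coprime_iff_combination_eq_one by blast
  then have "c = c * (u * a + v * b)" by simp
  also have "\<dots> = a * (u * c) + v * (b * c)" by (simp add: algebra_simps)
  finally have "c = a * (u * c) + v * (b * c)" .
  moreover have "a dvd a * (u * c) + v * (b * c)" using assms(2) by simp
  ultimately show ?thesis by simp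
qed

lemma coprime_mult_rightI:
  fixes a b c :: "'a::euclidean_ring"
  assumes "coprime a b" "coprime a c"
  shows "coprime a (b * c)"
proof -
  obtain u v u' v' where 1: "u * a + v * b = 1" "u' * a + v' * c = 1"
    using assms coprime_iff_combination_eq_one by metis
  have "(u * u' * a + u * v' * c + v * b * u') * a + (v * v') * (b * c)
      = (u * a + v * b) * (u' * a + v' * c)" by (simp add: algebra_simps)
  also have "\<dots> = 1" using 1 by simp
  finally show ?thesis using coprime_iff_combination_eq_one by blast
qed

lemma coprime_power_rightI:
  fixes a b :: "'a::euclidean_ring"
  shows "coprime a b \<Longrightarrow> coprime a (b ^ n)"
  by (induction n) (auto intro: coprime_mult_rightI)

lemma coprime_powerI:
  fixes a b :: "'a::euclidean_ring"
  shows "coprime a b \<Longrightarrow> coprime (a ^ m) (b ^ n)"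
  by (meson coprime_commute coprime_power_rightI)

lemma coprime_mult_dvdI:
  fixes a b c :: "'a::euclidean_ring"
  assumes "coprime a b" "a dvd c" "b dvd c"
  shows "a * b dvd c"
proof -
  obtain k where k: "c = a * k" using assms(2) ..
  have "coprime b a" using assms(1) by (simp add: coprime_commute)
  then have "b dvd k" using assms(3) unfolding k by (rule coprime_dvd_mult_cancel)
  then show ?thesis using k by (simp add: mult_dvd_mono)
qed

section \<open>Wronskians and the Mason-Stothers theorem\<close>

text \<open>Stands in for the radical of \<open>X\<close>, which needs a factorial ring structure.\<close>

lemma dvd_mult_pderiv_of_dvd_power:
  fixes X R :: "'a::field_char_0 poly"
  assumes "X dvd R ^ n"
  shows "X dvd R * pderiv X"
  using assms
proof (induction n arbitrary: X)
  case 0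
  then have "degree X = 0" by (auto simp: is_unit_poly_iff)
  then show ?case by (simp add: pderiv_eq_0_iff)
next
  case (Suc n)
  \<comment> \<open>Dividing \<open>X\<close> and \<open>R\<close> by their greatest common divisor
    \<open>G\<close> leaves coprime cofactors \<open>Y\<close> and \<open>S\<close>. Since
    \<open>Y\<close> divides \<open>S * R ^ n\<close>, it divides \<open>R ^ n\<close>, which lowers
    the exponent; the product rule for \<open>G * Y\<close> then returns to
    \<open>X\<close>.\<close>
  obtain G u v where G: "G = u * X + v * R" "G dvd X" "G dvd R"
    using ex_common_divisor_combination by blast
  obtain Y where Y: "X = G * Y" using G(2) ..
  obtain S where S: "R = G * S" using G(3) ..
  show ?case
  proof (cases "G = 0")
    case True
    then show ?thesis using Y S by simp
  next
    case False
    have "G * 1 = G * (u * Y + v * S)" using G(1) Y S by (simp add: algebra_simps)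
    then have "u * Y + v * S = 1" using False mult_cancel_left[of G 1] by auto
    then have "coprime Y S" using coprime_iff_combination_eq_one by blast
    moreover have "Y dvd S * R ^ n"
    proof -
      have "G * Y dvd G * (S * R ^ n)" using Suc.prems Y S by (simp add: mult.assoc)
      then show ?thesis using False by simp
    qed
    ultimately have "Y dvd R ^ n" by (rule coprime_dvd_mult_cancel)
    then have "Y dvd R * pderiv Y" by (rule Suc.IH)
    then have "X dvd G * (R * pderiv Y)" unfolding Y by (rule mult_dvd_mono[OF dvd_refl])
    moreover have "X dvd R * Y * pderiv G" using Y S by simp
    moreover have "R * pderiv X = G * (R * pderiv Y) + R * Y * pderiv G"
      unfolding Y pderiv_mult by (simp add: algebra_simps)
    ultimately show ?thesis by simp
  qed
qed

lemma degree_wronskian_less: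
  fixes X Y :: "'a::field_char_0 poly"
  assumes "pderiv X * Y - X * pderiv Y \<noteq> 0"
  shows "degree (pderiv X * Y - X * pderiv Y) < degree X + degree Y"
proof -
  have 1: "pderiv X * Y \<noteq> 0 \<Longrightarrow> degree (pderiv X * Y) < degree X + degree Y"
    by (simp add: degree_mult_eq degree_pderiv pderiv_eq_0_iff)
  have 2: "X * pderiv Y \<noteq> 0 \<Longrightarrow> degree (X * pderiv Y) < degree X + degree Y"
    by (simp add: degree_mult_eq degree_pderiv pderiv_eq_0_iff)
  \<comment> \<open>A vanishing product has degree 0, so the strict bounds 1 and 2 extend to it only
    if the sum of the degrees is positive.\<close>
  have "0 < degree X + degree Y"
  proof (rule ccontr)
    assume "\<not> ?thesis"
    then have "pderiv X = 0" "pderiv Y = 0" by (simp_all add: pderiv_eq_0_iff)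
    then show False using assms by simp
  qed
  then have "degree (pderiv X * Y) < degree X + degree Y" "degree (X * pderiv Y) < degree X + degree Y"
    using 1 2 degree_0 by metis+
  then show ?thesis by (rule degree_diff_less)
qed

text \<open>If the Wronskian vanished, coprimality would make \<open>X\<close> divide its own
  derivative, which is nonzero and of smaller degree.\<close>

lemma wronskian_nonzero:
  fixes X Y :: "'a::field_char_0 poly"
  assumes "coprime X Y" "degree X > 0"
  shows "pderiv X * Y - X * pderiv Y \<noteq> 0"
proof
  assume "pderiv X * Y - X * pderiv Y = 0"
  then have "Y * pderiv X = X * pderiv Y" by (simp add: mult.commute)
  then have "X dvd Y * pderiv X" by simp
  then have "X dvd pderiv X" using assms(1) coprime_dvd_mult_cancel by blast
  then show False using assms(2) by simp
qed

text \<open>All pairs among \<open>X\<close>, \<open>Y\<close>, \<open>Z\<close> have the same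
  Wronskian \<open>W\<close> up to sign, and each of the three divides \<open>R * W\<close>. By
  coprimality so does their product; bounding \<open>degree W\<close> by the degrees of two of them
  then bounds the degree of the third by that of \<open>R\<close>.\<close>

lemma mason_stothers_aux:
  fixes X Y Z R :: "'a::field_char_0 poly"
  assumes sum: "X + Y = Z" and XY: "coprime X Y" and dvd: "X * Y * Z dvd R ^ n"
    and nz: "X * Y * Z \<noteq> 0" "R \<noteq> 0" and deg: "degree X > 0"
  shows "degree Z < degree R" "degree Y < degree R"
proof -
  define W where "W = pderiv X * Y - X * pderiv Y"
  have XZ: "coprime X Z" using XY sum
    by (metis coprime_def dvd_add_right_iff)
  have YZ: "coprime Y Z" using XY sum
    by (metis coprime_def dvd_add_left_iff)
  have W2: "W = pderiv X * Z - X * pderiv Z"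
    unfolding W_def sum[symmetric] by (simp add: pderiv_add algebra_simps)
  have X: "X dvd R * pderiv X" and Y: "Y dvd R * pderiv Y" and Z: "Z dvd R * pderiv Z"
    using dvd by (metis dvd_mult_pderiv_of_dvd_power dvd_mult_left dvd_mult_right)+
  have "X dvd (R * pderiv X) * Y - X * (R * pderiv Y)" using X by simp
  then have 1: "X dvd R * W" by (simp add: W_def algebra_simps)
  have "Y dvd (R * pderiv X) * Y - X * (R * pderiv Y)" using Y by simp
  then have 2: "Y dvd R * W" by (simp add: W_def algebra_simps)
  have "Z dvd (R * pderiv X) * Z - X * (R * pderiv Z)" using Z by simp
  then have 3: "Z dvd R * W" by (simp add: W2 algebra_simps)
  have "Z * (X * Y) dvd R * W"
    using XY XZ[THEN coprime_commute[THEN iffD1]] YZ[THEN coprime_commute[THEN iffD1]] 1 2 3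
    by (intro coprime_mult_dvdI coprime_mult_rightI)
  moreover have W0: "W \<noteq> 0" unfolding W_def by (rule wronskian_nonzero[OF XY deg])
  ultimately have *: "degree X + degree Y + degree Z \<le> degree R + degree W"
    using nz dvd_imp_degree_le[of "Z * (X * Y)" "R * W"] by (auto simp: degree_mult_eq)
  have "degree W < degree X + degree Y" using W0 degree_wronskian_less unfolding W_def by blast
  with * show "degree Z < degree R" by simp
  have "degree W < degree X + degree Z" using W0 degree_wronskian_less unfolding W2 by blast
  with * show "degree Y < degree R" by simp
qed

text \<open>The classical statement has the radical of \<open>X * Y * Z\<close> as \<open>R\<close>;
  here any nonzero \<open>R\<close> with a power divisible by the product serves.\<close>

theorem mason_stothers:
  fixes X Y Z R :: "'a::field_char_0 poly"
  assumes sum: "X + Y + Z = 0" and XY: "coprime X Y" and dvd: "X * Y * Z dvd R ^ n"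
    and nz: "R \<noteq> 0" and deg: "degree X > 0 \<or> degree Y > 0"
  shows "degree X < degree R" "degree Y < degree R" "degree Z < degree R"
proof -
  have nz': "X * Y * Z \<noteq> 0" using dvd nz by (metis dvd_0_left_iff power_not_zero)
  have *: "degree X < degree R \<and> degree Y < degree R \<and> degree Z < degree R"
    if "X + Y + Z = 0" "coprime X Y" "X * Y * Z dvd R ^ n" "X * Y * Z \<noteq> 0" "degree X > 0" for X Y Z
  proof -
    have "X + Y = - Z" using that(1) by (simp add: eq_neg_iff_add_eq_0)
    then have 1: "degree (-Z) < degree R" "degree Y < degree R"
      using mason_stothers_aux[of X Y "-Z" R n] that nz by auto
    \<comment> \<open>The remaining degree is controlled because \<open>X\<close> is the difference
      of \<open>- Z\<close> and \<open>Y\<close>.\<close>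
    moreover have "degree X \<le> max (degree (-Z)) (degree Y)"
      using \<open>X + Y = - Z\<close> degree_diff_le_max[of "-Z" Y] by (metis add_diff_cancel_right')
    ultimately show ?thesis by simp
  qed
  have "degree X < degree R \<and> degree Y < degree R \<and> degree Z < degree R"
    using deg
  proof
    assume "degree X > 0"
    then show ?thesis using *[OF sum XY dvd nz'] by blast
  next
    assume "degree Y > 0"
    moreover have "Y + X + Z = 0" "Y * X * Z dvd R ^ n" "Y * X * Z \<noteq> 0"
      using sum dvd nz' by (simp_all add: add.commute mult.commute)
    moreover have "coprime Y X" using XY by (simp add: coprime_commute)
    ultimately show ?thesis using *[of Y X Z] by blast
  qed
  then show "degree X < degree R" "degree Y < degree R" "degree Z < degree R" by auto
qed

section \<open>Signed quadratic triples and relations with two equal exponents\<close>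

text \<open>Signs are modelled as polynomials squaring to 1, so that 1 and -1 are treated uniformly;
  being units, they are nonzero constants.\<close>

lemma involution_poly:
  fixes e :: "'a::field_char_0 poly"
  assumes "e * e = 1"
  shows "e \<noteq> 0" "degree e = 0" "pderiv e = 0" "e dvd 1"
proof -
  show "e \<noteq> 0" using assms by auto
  show "e dvd 1" using assms by (metis dvd_triv_left)
  then show "degree e = 0" by (auto simp: is_unit_poly_iff)
  then show "pderiv e = 0" by (simp add: pderiv_eq_0_iff)
qed

lemma degree_involution_mult:
  fixes e p :: "'a::field_char_0 poly"
  assumes "e * e = 1"
  shows "degree (e * p) = degree p"
  using involution_poly[OF assms] by (cases "p = 0") (simp_all add: degree_mult_eq)

text \<open>Each sign is paired with its polynomial, so the hypotheses are invariant under permuting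
  the three pairs. The transposition \<open>swap\<close> and the 3-cycle \<open>rotate\<close>
  generate all six orders.\<close>

locale quadratic_triple =
  fixes e1 A e2 B e3 C :: "'a::field_char_0 poly"
  assumes inv: "e1 * e1 = 1" "e2 * e2 = 1" "e3 * e3 = 1"
    and rel: "e1 * A\<^sup>2 + e2 * B\<^sup>2 + e3 * C\<^sup>2 = 0"
    and cop: "coprime A B" "coprime A C" "coprime B C"
    and deg: "degree A > 0" "degree B > 0" "degree C > 0"
begin

lemma swap: "quadratic_triple e2 B e1 A e3 C"
  using inv rel cop deg by unfold_locales (simp_all add: coprime_commute[of B A] add.commute)

lemma rotate: "quadratic_triple e2 B e3 C e1 A"
  using inv rel cop deg
  by unfold_locales (simp_all add: coprime_commute[of B A] coprime_commute[of C A] add_ac)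

lemma nonzero: "A \<noteq> 0" "B \<noteq> 0" "C \<noteq> 0" "e1 \<noteq> 0" "e2 \<noteq> 0" "e3 \<noteq> 0"
  using deg inv[THEN involution_poly(1)] by auto

lemma degree_le_max: "degree C \<le> max (degree A) (degree B)"
proof -
  have "e3 * C\<^sup>2 = - (e1 * A\<^sup>2) - e2 * B\<^sup>2" using rel by (simp add: algebra_simps add_eq_0_iff)
  then have "degree (e3 * C\<^sup>2) \<le> max (degree (e1 * A\<^sup>2)) (degree (e2 * B\<^sup>2))"
    using degree_diff_le_max[of "- (e1 * A\<^sup>2)" "e2 * B\<^sup>2"] by simp
  then show ?thesis
    using nonzero inv[THEN involution_poly(2)] by (simp add: degree_mult_eq degree_power_eq)
qed

text \<open>The quadratic relation and its derivative are two linear equations in the signs.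
  Eliminating one sign shows that \<open>C\<close> divides \<open>A\<close> times the Wronskian,
  hence the Wronskian itself.\<close>

lemma wronskian_factor:
  obtains V where "pderiv A * B - A * pderiv B = C * V" "V \<noteq> 0" "degree V < degree C"
proof -
  define W where "W = pderiv A * B - A * pderiv B"
  have "pderiv (e1 * A\<^sup>2 + e2 * B\<^sup>2 + e3 * C\<^sup>2) = 2 * (e1 * A * pderiv A + e2 * B * pderiv B + e3 * C * pderiv C)"
    using inv[THEN involution_poly(3)]
    by (simp add: pderiv_add pderiv_mult power2_eq_square algebra_simps)
  then have "2 * (e1 * A * pderiv A + e2 * B * pderiv B + e3 * C * pderiv C) = 0"
    unfolding rel by simp
  then have d: "e1 * A * pderiv A + e2 * B * pderiv B + e3 * C * pderiv C = 0"
    by (simp only: mult_eq_0_iff) simp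
  \<comment> \<open>\<open>B\<close> times the differentiated relation minus \<open>pderiv B\<close>
    times the relation: the terms with \<open>e2\<close> cancel.\<close>
  have a: "e1 * A * W = e3 * C * (C * pderiv B - pderiv C * B)"
  proof -
    have "e1 * A * W - e3 * C * (C * pderiv B - pderiv C * B)
      = B * (e1 * A * pderiv A + e2 * B * pderiv B + e3 * C * pderiv C)
        - pderiv B * (e1 * A\<^sup>2 + e2 * B\<^sup>2 + e3 * C\<^sup>2)"
      unfolding W_def by (simp add: algebra_simps power2_eq_square)
    then show ?thesis unfolding d rel by simp
  qed
  have b: "e2 * B * W = e3 * C * (pderiv C * A - C * pderiv A)"
  proof -
    have "e2 * B * W - e3 * C * (pderiv C * A - C * pderiv A)
      = - A * (e1 * A * pderiv A + e2 * B * pderiv B + e3 * C * pderiv C)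
        + pderiv A * (e1 * A\<^sup>2 + e2 * B\<^sup>2 + e3 * C\<^sup>2)"
      unfolding W_def by (simp add: algebra_simps power2_eq_square)
    then show ?thesis unfolding d rel by simp
  qed
  have "C dvd A * W"
  proof -
    have "C dvd e1 * (e1 * A * W)" unfolding a by simp
    also have "e1 * (e1 * A * W) = (e1 * e1) * (A * W)" by (simp only: mult_ac)
    finally show ?thesis unfolding inv by simp
  qed
  moreover have "coprime C A" using cop(2) by (simp add: coprime_commute)
  ultimately have "C dvd W" using coprime_dvd_mult_cancel by blast
  then obtain V where V: "W = C * V" ..
  have W0: "W \<noteq> 0" unfolding W_def by (rule wronskian_nonzero[OF cop(1) deg(1)])
  then have V0: "V \<noteq> 0" using V by auto
  have aV: "e1 * (A * V) = e3 * (C * pderiv B - pderiv C * B)"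
    using a nonzero unfolding V by (simp add: mult_ac)
  have bV: "e2 * (B * V) = e3 * (pderiv C * A - C * pderiv A)"
    using b nonzero unfolding V by (simp add: mult_ac)
  \<comment> \<open>Of the identities \<open>aV\<close> and \<open>bV\<close>, the one containing
    the polynomial of larger degree is used: that degree outweighs the other one in the Wronskian
    bound.\<close>
  have "degree V < degree C"
  proof (cases "degree B \<le> degree A")
    case True
    have "degree A + degree V = degree (C * pderiv B - pderiv C * B)"
      using arg_cong[OF aV, of degree] nonzero V0 inv by (simp add: degree_involution_mult degree_mult_eq)
    also have "\<dots> = degree (pderiv C * B - C * pderiv B)" by (metis degree_minus minus_diff_eq)
    also have "\<dots> < degree C + degree B"
      by (rule degree_wronskian_less, rule wronskian_nonzero)
        (use cop deg in \<open>simp_all add: coprime_commute[of C B]\<close>)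
    finally show ?thesis using True by simp
  next
    case False
    have "degree B + degree V = degree (pderiv C * A - C * pderiv A)"
      using arg_cong[OF bV, of degree] nonzero V0 inv by (simp add: degree_involution_mult degree_mult_eq)
    also have "\<dots> < degree C + degree A"
      by (rule degree_wronskian_less, rule wronskian_nonzero)
        (use cop deg in \<open>simp_all add: coprime_commute[of C A]\<close>)
    finally show ?thesis using False by simp
  qed
  with V V0 show ?thesis using that unfolding W_def by blast
qed

text \<open>A high power of \<open>C\<close> dividing \<open>A\<^sup>x \<plusminus> B\<^sup>x\<close> would divide the
  cofactor \<open>V\<close> of \<open>C\<close> in the Wronskian of \<open>A\<close> and \<open>B\<close>, which is too small.\<close>

lemma power_dvd_sum_powers_le_2:
  assumes dvd: "C ^ z dvd e1 * A ^ x + e2 * B ^ x" and "x > 0"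
  shows "z \<le> 2"
proof (rule ccontr)
  assume "\<not> z \<le> 2"
  \<comment> \<open>Of the three guaranteed factors \<open>C\<close>, one is lost by differentiation
    and one to the factor \<open>C\<close> of the Wronskian; the third must divide \<open>V\<close>
    up to a constant.\<close>
  then obtain m where m: "z = Suc (Suc (Suc m))" by (metis not_less_eq_eq numeral_2_eq_2 Suc_le_D)
  obtain n where n: "x = Suc n" using \<open>x > 0\<close> gr0_implies_Suc by blast
  define N where "N = e1 * A ^ x + e2 * B ^ x"
  define k where "k = [:of_nat (Suc n) :: 'a:]"
  obtain V where V: "pderiv A * B - A * pderiv B = C * V" "V \<noteq> 0" "degree V < degree C"
    by (rule wronskian_factor)
  obtain F where F: "N = C ^ z * F" using dvd unfolding N_def ..
  have "pderiv N = C ^ z * pderiv F + F * (smult (of_nat z) (C ^ Suc (Suc m)) * pderiv C)"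
    unfolding F pderiv_mult m pderiv_power_Suc by simp
  moreover have "C ^ Suc (Suc m) dvd C ^ z * pderiv F" unfolding m by simp
  ultimately have N': "C ^ Suc (Suc m) dvd pderiv N"
    by (metis dvd_add dvd_mult dvd_mult2 dvd_refl dvd_smult)
  have N: "C ^ Suc (Suc m) dvd N" unfolding F m by simp
  have "pderiv N = k * (e1 * A ^ n * pderiv A + e2 * B ^ n * pderiv B)"
    using inv[THEN involution_poly(3)] unfolding N_def n pderiv_add pderiv_mult pderiv_power_Suc k_def
    by (simp add: algebra_simps smult_add_right)
  \<comment> \<open>This combination of \<open>N\<close> and its derivative cancels the powers of
    \<open>A\<close> and leaves a power of \<open>B\<close> times the Wronskian.\<close>
  then have "k * e2 * B ^ n * (pderiv A * B - A * pderiv B) = k * pderiv A * N - A * pderiv N"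
    unfolding N_def n by (simp add: algebra_simps)
  then have "C ^ Suc (Suc m) dvd k * e2 * B ^ n * (C * V)"
    using N N' V(1) by (metis dvd_diff dvd_mult)
  then have "C ^ Suc m dvd B ^ n * (k * e2 * V)" using nonzero by (simp add: mult_ac)
  moreover have "coprime (C ^ Suc m) (B ^ n)"
    using cop(3) by (intro coprime_powerI) (simp add: coprime_commute)
  ultimately have "C ^ Suc m dvd k * e2 * V" using coprime_dvd_mult_cancel by blast
  then have "C dvd k * e2 * V" by (metis dvd_mult_left power_Suc)
  moreover have "k * e2 * V \<noteq> 0" "degree (k * e2 * V) = degree V"
    using V(2) nonzero inv[THEN involution_poly(2)]
    by (simp_all add: k_def degree_mult_eq del: mult_pCons_left of_nat_Suc)
  ultimately show False using V(3) dvd_imp_degree_le[of C "k * e2 * V"] by simp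
qed

text \<open>The smallest exponent occurs twice: cancelling \<open>w ^ x\<close> shows that
  \<open>C ^ z\<close> divides \<open>e1 * A ^ x + e2 * B ^ x\<close>, which bounds
  \<open>z\<close>.\<close>

lemma exponents_eq_le:
  assumes eq: "e1 * (w * A) ^ x + e2 * (w * B) ^ x + e3 * (w * C) ^ z = 0"
    and "w \<noteq> 0" "x > 0" "x \<le> z"
  shows "(x, z) \<in> {(1, 1), (1, 2), (2, 2)}"
proof -
  obtain d where z: "z = x + d" using \<open>x \<le> z\<close> le_Suc_ex by blast
  have "w ^ x * (e1 * A ^ x + e2 * B ^ x + e3 * w ^ d * C ^ z) = 0"
    using eq unfolding z by (simp add: power_mult_distrib power_add algebra_simps)
  then have "e1 * A ^ x + e2 * B ^ x + e3 * w ^ d * C ^ z = 0" using \<open>w \<noteq> 0\<close> by simp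
  then have "e1 * A ^ x + e2 * B ^ x = C ^ z * (- e3 * w ^ d)"
    by (simp add: add_eq_0_iff2 mult_ac)
  then have "C ^ z dvd e1 * A ^ x + e2 * B ^ x" by simp
  then have "z \<le> 2" using power_dvd_sum_powers_le_2 \<open>x > 0\<close> by blast
  then show ?thesis using \<open>x > 0\<close> \<open>x \<le> z\<close> by auto
qed

text \<open>The single exponent \<open>z\<close> is the smallest: cancelling \<open>w ^ z\<close>
  shows that \<open>e1 * A ^ x + e2 * B ^ x\<close> divides a power of \<open>C\<close>, so
  Mason-Stothers applies with \<open>A * B * C\<close> as \<open>R\<close>.\<close>

lemma not_exponents_less_eq:
  assumes eq: "e1 * (w * A) ^ x + e2 * (w * B) ^ x + e3 * (w * C) ^ z = 0"
    and "w \<noteq> 0" "z > 0" "z < x"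
  shows False
proof -
  obtain d where x: "x = z + Suc d" using \<open>z < x\<close> less_imp_Suc_add by fastforce
  define F where "F = - (e1 * A ^ x + e2 * B ^ x)"
  have "w ^ z * (e3 * C ^ z - w ^ Suc d * F) = 0"
    using eq unfolding F_def x by (simp add: power_mult_distrib power_add algebra_simps)
  then have F: "w ^ Suc d * F = e3 * C ^ z" using \<open>w \<noteq> 0\<close> by simp
  have "F dvd e3 * C ^ z" unfolding F[symmetric] by simp
  then have "F dvd C ^ z" using inv[THEN involution_poly(4)]
    by (metis dvd_mult_unit_iff mult.commute)
  then have "F dvd C ^ x" using \<open>z < x\<close> by (meson dvd_trans le_imp_power_dvd less_imp_le)
  then have dvd: "e1 * A ^ x * (e2 * B ^ x) * F dvd (A * B * C) ^ x"
    using inv[THEN involution_poly(4)]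
    by (simp add: power_mult_distrib mult_dvd_mono mult_unit_dvd_iff' )
  have cop': "coprime (e1 * A ^ x) (e2 * B ^ x)"
    using inv[THEN involution_poly(4)] coprime_powerI[OF cop(1)]
    by (meson coprime_commute coprime_mult_rightI is_unit_left_imp_coprime)
  have "degree (e1 * A ^ x) = x * degree A" "degree (e2 * B ^ x) = x * degree B"
    using inv nonzero by (simp_all add: degree_involution_mult degree_power_eq)
  moreover have "degree (A * B * C) = degree A + degree B + degree C"
    using nonzero by (simp add: degree_mult_eq)
  ultimately have "x * degree A < degree A + degree B + degree C"
    "x * degree B < degree A + degree B + degree C"
    using mason_stothers[OF _ cop' dvd] nonzero deg \<open>z < x\<close> by (simp_all add: F_def)
  moreover have "x * max (degree A) (degree B) = max (x * degree A) (x * degree B)"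
    by (simp add: nat_mult_max_right)
  \<comment> \<open>All three degrees are at most the maximum of those of \<open>A\<close> and
    \<open>B\<close>, whence the factor 3.\<close>
  ultimately have "x * max (degree A) (degree B) < 3 * max (degree A) (degree B)"
    using degree_le_max by linarith
  then have "x < 3" by (simp only: mult_less_cancel2)
  then have xz: "x = 2" "z = 1" using \<open>z < x\<close> \<open>z > 0\<close> by auto
  then have "d = 0" using x by simp
  \<comment> \<open>For exponents 2, 2, 1 the quadratic relation evaluates \<open>F\<close>, and
    \<open>w * C = 1\<close> contradicts \<open>C\<close> being nonconstant.\<close>
  have "F = e3 * C\<^sup>2" using rel unfolding F_def xz by (simp add: algebra_simps add_eq_0_iff)
  then have "e3 * C * (w * C) = e3 * C * 1" using F xz \<open>d = 0\<close> by (simp add: power2_eq_square mult_ac)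
  then have "w * C = 1" using nonzero by (metis mult_cancel_left mult_eq_0_iff)
  then have "C dvd 1" by (metis dvd_triv_right)
  then show False using deg by (auto simp: is_unit_poly_iff)
qed

end

section \<open>Factoring one member of a triple\<close>

text \<open>The usual parametrization of Pythagorean triples, up to scalars. The sign
  \<open>s\<close> allows \<open>A\<close> and \<open>B\<close> to be exchanged, and the scalars can
  absorb a square root of -1.\<close>

definition splits :: "'a::field_char_0 poly \<Rightarrow> 'a poly \<Rightarrow> 'a poly \<Rightarrow> bool" where
  "splits A B C \<longleftrightarrow> (\<exists>P Q k l c s. s * s = 1 \<and>
     A = smult k (P\<^sup>2 - smult s (Q\<^sup>2)) \<and> B = smult l (P\<^sup>2 + smult s (Q\<^sup>2)) \<and> C = smult c (P * Q))"

lemma splits_commute: "splits A B C \<Longrightarrow> splits B A C"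
  unfolding splits_def
proof (elim exE conjE, intro exI conjI)
  fix P Q k l c s
  assume "s * s = 1" "A = smult k (P\<^sup>2 - smult s (Q\<^sup>2))" "B = smult l (P\<^sup>2 + smult s (Q\<^sup>2))"
    "C = smult c (P * Q)"
  then show "- s * - s = 1" "B = smult l (P\<^sup>2 - smult (- s) (Q\<^sup>2))"
    "A = smult k (P\<^sup>2 + smult (- s) (Q\<^sup>2))" "C = smult c (P * Q)" by simp_all
qed

text \<open>Equal degrees of \<open>P\<close> and \<open>Q\<close> would give \<open>C\<close>
  degree \<open>2 * degree P\<close>, at least that of \<open>A\<close>. So the degrees differ, and
  exchanging \<open>P\<close> and \<open>Q\<close> only changes the scalars because
  \<open>s * s = 1\<close>.\<close>

lemma splits_degree_less:
  assumes "splits A B C" "degree C < degree A" "C \<noteq> 0"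
  obtains P Q k l c s where "s * s = 1" "degree Q < degree P"
    "A = smult k (P\<^sup>2 - smult s (Q\<^sup>2))" "B = smult l (P\<^sup>2 + smult s (Q\<^sup>2))" "C = smult c (P * Q)"
proof -
  obtain P Q k l c s where *: "s * s = 1"
    "A = smult k (P\<^sup>2 - smult s (Q\<^sup>2))" "B = smult l (P\<^sup>2 + smult s (Q\<^sup>2))" "C = smult c (P * Q)"
    using assms(1) unfolding splits_def by metis
  have nz: "P \<noteq> 0" "Q \<noteq> 0" "c \<noteq> 0" using assms(3) * by auto
  have "degree P \<noteq> degree Q"
  proof
    assume eq: "degree P = degree Q"
    have "degree A \<le> degree (P\<^sup>2 - smult s (Q\<^sup>2))" unfolding * by (rule degree_smult_le)
    also have "\<dots> \<le> 2 * degree P"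
      using nz eq by (intro degree_diff_le order.trans[OF degree_smult_le]) (simp_all add: degree_power_eq)
    also have "\<dots> = degree C" using nz eq * by (simp add: degree_mult_eq)
    finally show False using assms(2) by simp
  qed
  then consider "degree Q < degree P" | "degree P < degree Q" by linarith
  then show ?thesis
  proof cases
    case 1
    then show ?thesis using that * by blast
  next
    case 2
    have "A = smult (- k * s) (Q\<^sup>2 - smult s (P\<^sup>2))"
      using *(1) unfolding *(2) by (simp add: smult_diff_right mult.assoc)
    moreover have "B = smult (l * s) (Q\<^sup>2 + smult s (P\<^sup>2))"
      using *(1) unfolding *(3) by (simp add: smult_add_right mult.assoc)
    moreover have "C = smult c (Q * P)" using * by (simp add: mult.commute)
    ultimately show ?thesis using that *(1) 2 by blast
  qed
qed

section \<open>Relations with distinct exponents, and all exponent patterns together\<close>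

context quadratic_triple
begin

text \<open>The hypothesis \<open>eq\<close> is the relation with exponents 1, 2, \<open>z\<close>
  divided by the square of \<open>w\<close>. Reduction modulo \<open>P ^ 3\<close> determines
  \<open>A'\<close> exactly; this forces \<open>Q\<close> and \<open>w\<close> to be constant, and
  comparing coefficients gives a contradiction.\<close>

lemma exponents_1_2_impossible:
  assumes eq: "e1 * A' + e2 * B\<^sup>2 + e3 * w ^ d * C ^ z = 0" and A: "A = w * A'"
    and z: "z \<ge> 3" and less: "degree C < degree A" and AB: "degree A = degree B"
    and "splits A B C"
  shows False
proof -
  obtain P Q k l c s where s: "s * s = 1" and QP: "degree Q < degree P"
    and PQ: "A = smult k (P\<^sup>2 - smult s (Q\<^sup>2))" "B = smult l (P\<^sup>2 + smult s (Q\<^sup>2))" "C = smult c (P * Q)"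
    by (rule splits_degree_less[OF \<open>splits A B C\<close> less nonzero(3)])
  have nz: "k \<noteq> 0" "l \<noteq> 0" "c \<noteq> 0" "P \<noteq> 0" "Q \<noteq> 0" "s \<noteq> 0" "w \<noteq> 0" "A' \<noteq> 0"
  proof -
    show "k \<noteq> 0" using nonzero(1) PQ(1) by auto
    show "l \<noteq> 0" using nonzero(2) PQ(2) by auto
    show "c \<noteq> 0" "P \<noteq> 0" "Q \<noteq> 0" using nonzero(3) PQ(3) by auto
    show "s \<noteq> 0" using s by auto
    show "w \<noteq> 0" "A' \<noteq> 0" using nonzero(1) A by auto
  qed
  define p q where "p = degree P" and "q = degree Q"
  have "degree (smult s (Q\<^sup>2)) < degree (P\<^sup>2)" using QP nz by (simp add: degree_power_eq)
  then have "degree (P\<^sup>2 - smult s (Q\<^sup>2)) = 2 * p"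
    using nz degree_add_eq_left[of "- smult s (Q\<^sup>2)" "P\<^sup>2"] by (simp add: degree_power_eq p_def)
  then have dA: "degree A = 2 * p" using nz unfolding PQ by simp
  have dC: "degree C = p + q" using nz unfolding PQ p_def q_def by (simp add: degree_mult_eq)
  have dA': "degree A = degree w + degree A'" unfolding A using nz by (simp add: degree_mult_eq)
  have "e3 * (w ^ d * C ^ z) = - (e1 * A') - e2 * B\<^sup>2"
    using eq by (simp add: algebra_simps add_eq_0_iff)
  then have "degree (e3 * (w ^ d * C ^ z)) \<le> max (degree (e1 * A')) (degree (e2 * B\<^sup>2))"
    using degree_diff_le_max[of "- (e1 * A')" "e2 * B\<^sup>2"] by simp
  then have "degree (w ^ d * C ^ z) \<le> max (degree A') (2 * degree B)"
    using inv nz nonzero by (simp add: degree_involution_mult degree_power_eq)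
  then have "z * (p + q) \<le> 4 * p"
    using dA dA' AB dC nz nonzero by (simp add: degree_mult_eq degree_power_eq)
  moreover have "3 * (p + q) \<le> z * (p + q)" using z by (rule mult_le_mono1)
  ultimately have "3 * (p + q) \<le> 4 * p" by (rule order.trans[rotated])
  then have pq: "3 * q \<le> p" by simp
  \<comment> \<open>\<open>T\<close> is \<open>e1 * A' + e2 * B\<^sup>2\<close> without the multiple
    of \<open>P ^ 4\<close> in the expansion of \<open>B\<^sup>2\<close>, hence still divisible by
    \<open>P ^ 3\<close>.\<close>
  define T where "T = e1 * A' + e2 * smult (l * l) (smult (2 * s) (P\<^sup>2) + Q\<^sup>2) * Q\<^sup>2"
  have B2: "B\<^sup>2 = smult (l * l) (P ^ 4 + (smult (2 * s) (P\<^sup>2) + Q\<^sup>2) * Q\<^sup>2)"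
  proof -
    define S where "S = [:s:]"
    have S1: "smult s X = S * X" for X unfolding S_def by simp
    have "S * S = [:s * s:]" unfolding S_def by simp
    then have S2: "S * S = 1" unfolding s by (simp add: one_pCons)
    have "smult (2 * s) X = S * X + S * X" for X
      unfolding mult_2 smult_add_left S1 ..
    then have S3: "smult (2 * s) X = 2 * S * X" for X by simp
    have "(P\<^sup>2 + S * Q\<^sup>2)\<^sup>2 = P ^ 4 + 2 * S * P\<^sup>2 * Q\<^sup>2 + (S * S) * Q ^ 4"
      by (simp add: power2_eq_square power4_eq_xxxx algebra_simps)
    also have "\<dots> = P ^ 4 + (2 * S * P\<^sup>2 + Q\<^sup>2) * Q\<^sup>2"
      unfolding S2 by (simp add: power2_eq_square power4_eq_xxxx algebra_simps)
    finally have "(P\<^sup>2 + smult s (Q\<^sup>2))\<^sup>2 = P ^ 4 + (smult (2 * s) (P\<^sup>2) + Q\<^sup>2) * Q\<^sup>2"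
      unfolding S1 S3 .
    then show ?thesis unfolding PQ by (simp add: power2_eq_square)
  qed
  have "P ^ 3 dvd T"
  proof -
    have "P ^ 3 dvd C ^ 3" unfolding PQ by (simp add: power_mult_distrib smult_power dvd_smult)
    then have "P ^ 3 dvd C ^ z" using z by (meson dvd_trans le_imp_power_dvd)
    then have "P ^ 3 dvd e3 * w ^ d * C ^ z" by simp
    moreover have "P ^ 3 dvd e2 * smult (l * l) (P ^ 4)"
      by (intro dvd_mult dvd_smult le_imp_power_dvd) simp
    moreover have "T = - (e3 * w ^ d * C ^ z + e2 * smult (l * l) (P ^ 4))"
    proof -
      have "T + (e3 * w ^ d * C ^ z + e2 * smult (l * l) (P ^ 4)) = 0"
        unfolding eq[symmetric] B2 T_def by (simp add: smult_add_right algebra_simps)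
      then show ?thesis by (simp only: eq_neg_iff_add_eq_0)
    qed
    ultimately show ?thesis by simp
  qed
  moreover have "degree T < degree (P ^ 3)"
  proof -
    have "degree (smult (2 * s) (P\<^sup>2) + Q\<^sup>2) \<le> 2 * p"
      using QP nz unfolding p_def by (intro degree_add_le order.trans[OF degree_smult_le]) (simp_all add: degree_power_eq)
    moreover have "degree (smult (l * l) ((smult (2 * s) (P\<^sup>2) + Q\<^sup>2) * Q\<^sup>2))
        \<le> degree (smult (2 * s) (P\<^sup>2) + Q\<^sup>2) + 2 * q"
      by (rule order.trans[OF degree_smult_le], rule order.trans[OF degree_mult_le])
        (use nz in \<open>simp add: degree_power_eq q_def\<close>)
    ultimately have "degree (e2 * smult (l * l) ((smult (2 * s) (P\<^sup>2) + Q\<^sup>2) * Q\<^sup>2)) \<le> 2 * p + 2 * q"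
      using inv nz by (simp add: degree_involution_mult)
    moreover have "degree (e1 * A') \<le> 2 * p" using dA dA' inv by (simp add: degree_involution_mult)
    ultimately have "degree T \<le> 2 * p + 2 * q"
      unfolding T_def by (intro degree_add_le) (simp_all add: mult.assoc)
    \<comment> \<open>Here \<open>2 * q < p\<close>: for \<open>q = 0\<close> because
      \<open>q < p\<close>, otherwise because \<open>3 * q \<le> p\<close>.\<close>
    also have "\<dots> < 3 * p" using pq QP unfolding p_def q_def by linarith
    finally show ?thesis using nz by (simp add: degree_power_eq p_def)
  qed
  ultimately have T: "T = 0" using dvd_imp_degree_le[of "P ^ 3" T] by (meson not_le)
  have eA': "e1 * A' = - (e2 * smult (l * l) (smult (2 * s) (P\<^sup>2) + Q\<^sup>2) * Q\<^sup>2)"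
    using T unfolding T_def by (simp add: add_eq_0_iff2)
  have "Q dvd e1 * A'" unfolding eA' by (simp add: power2_eq_square dvd_smult)
  then have "Q dvd A'" using inv(1) by (metis dvd_mult_unit_iff involution_poly(4) mult.commute)
  then have "Q dvd A" unfolding A by simp
  moreover have "Q dvd C" unfolding PQ by (simp add: dvd_smult)
  ultimately have "Q dvd 1" using cop(2) coprime_common_divisor by blast
  then obtain r where r: "Q = [:r:]" by (auto simp: is_unit_poly_iff)
  have r0: "r \<noteq> 0" using nz r by auto
  have "degree (smult (2 * s) (P\<^sup>2) + Q\<^sup>2) = 2 * p"
    using QP nz degree_add_eq_left[of "Q\<^sup>2" "smult (2 * s) (P\<^sup>2)"]
    by (simp add: degree_power_eq p_def)
  then have "degree (e1 * A') = 2 * p"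
    using nz r inv QP unfolding eA' by (simp add: degree_involution_mult mult.assoc degree_mult_eq p_def power2_eq_square)
  then have "degree w = 0" using dA dA' inv by (simp add: degree_involution_mult)
  then obtain w0 where w: "w = [:w0:]" by (auto elim: degree_eq_zeroE)
  have w0: "w0 \<noteq> 0" using w nz by auto
  obtain E1 where E1: "e1 = [:E1:]" using involution_poly(2)[OF inv(1)] by (auto elim: degree_eq_zeroE)
  obtain E2 where E2: "e2 = [:E2:]" using involution_poly(2)[OF inv(2)] by (auto elim: degree_eq_zeroE)
  have E: "E1 \<noteq> 0" "E2 \<noteq> 0" using nonzero E1 E2 by auto
  \<comment> \<open>With \<open>Q\<close> and \<open>w\<close> constant, \<open>e1 * A\<close> has
    two expressions in \<open>P\<^sup>2\<close>: the one from \<open>splits\<close>, and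
    \<open>w\<close> times the value of \<open>e1 * A'\<close> found from \<open>T = 0\<close>,
    where \<open>m\<close> collects the constants.\<close>
  define m where "m = w0 * E2 * (l * l) * (r * r)"
  have "e1 * A = w * (e1 * A')" unfolding A by (simp add: mult_ac)
  then have "smult (E1 * k) (P\<^sup>2 - [:s * (r * r):]) = - smult m (smult (2 * s) (P\<^sup>2) + [:r * r:])"
    unfolding eA' unfolding PQ E1 E2 w r m_def by (simp add: power2_eq_square mult_ac)
  then have coeffs: "coeff (smult (E1 * k) (P\<^sup>2 - [:s * (r * r):])) n
      = coeff (- smult m (smult (2 * s) (P\<^sup>2) + [:r * r:])) n" for n by simp
  have "coeff (smult (E1 * k + 2 * s * m) (P\<^sup>2)) n
      = coeff [:E1 * k * (s * (r * r)) - m * (r * r):] n" for n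
    using coeffs[of n] by (cases n) (simp_all add: algebra_simps)
  then have "smult (E1 * k + 2 * s * m) (P\<^sup>2) = [:E1 * k * (s * (r * r)) - m * (r * r):]"
    by (rule poly_eqI)
  then have 1: "degree (smult (E1 * k + 2 * s * m) (P\<^sup>2)) = 0"
    and 2: "E1 * k + 2 * s * m = 0 \<Longrightarrow> E1 * k * (s * (r * r)) - m * (r * r) = 0" by auto
  \<comment> \<open>A constant multiple of the nonconstant \<open>P\<^sup>2\<close> is constant only
    if the multiplier is 0.\<close>
  have 3: "E1 * k + 2 * s * m = 0"
    using 1 QP nz by (auto simp: degree_power_eq split: if_splits)
  have "(E1 * k * s - m) * (r * r) = 0" using 2[OF 3] by (simp add: algebra_simps)
  then have "E1 * k * s = m" using r0 by simp
  moreover have "E1 * k = - (2 * s * m)" using 3 by (simp add: add_eq_0_iff2)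
  \<comment> \<open>The two coefficient equations give \<open>m = - 2 * m\<close>, impossible in
    characteristic 0 as \<open>m\<close> is a product of nonzero scalars.\<close>
  ultimately have "m = - (2 * (s * s) * m)" by (simp add: mult_ac)
  then have "3 * m = 0" unfolding s by (simp add: eq_neg_iff_add_eq_0)
  then show False unfolding m_def using w0 E r0 nz by simp
qed

text \<open>After cancelling \<open>w ^ x\<close>, both \<open>w\<close> and the cofactor
  \<open>E\<close> divide a power of \<open>A\<close>, so \<open>w\<close> is coprime to
  \<open>B\<close> and Mason-Stothers applies to the terms of \<open>E\<close>. The degree bounds
  leave only exponents 1, 2, \<open>z\<close>.\<close>

lemma not_exponents_less_less:
  assumes eq: "e1 * (w * A) ^ x + e2 * (w * B) ^ y + e3 * (w * C) ^ z = 0"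
    and "w \<noteq> 0" "x > 0" "x < y" "y < z"
    and split: "degree C < degree A \<Longrightarrow> splits A B C"
  shows False
proof -
  obtain d where y: "y = x + Suc d" using \<open>x < y\<close> less_imp_Suc_add by fastforce
  obtain d' where z: "z = y + Suc d'" using \<open>y < z\<close> less_imp_Suc_add by fastforce
  define E where "E = - (e2 * B ^ y + e3 * w ^ Suc d' * C ^ z)"
  have "w ^ x * (e1 * A ^ x - w ^ Suc d * E) = 0"
    using eq unfolding E_def z y by (simp add: power_mult_distrib power_add algebra_simps)
  then have E: "w ^ Suc d * E = e1 * A ^ x" using \<open>w \<noteq> 0\<close> by simp
  have "E dvd e1 * A ^ x" "w dvd e1 * A ^ x" unfolding E[symmetric] by simp_all
  then have EA: "E dvd A ^ x" and wA: "w dvd A ^ x"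
    using inv(1)[THEN involution_poly(4)] by (metis dvd_mult_unit_iff mult.commute)+
  have "coprime (A ^ x) B" using cop(1) by (metis coprime_commute coprime_power_rightI)
  then have wB: "coprime w B" using wA by (metis coprime_divisors dvd_refl)
  then have "coprime B (w ^ Suc d' * C ^ z)"
    using cop(3) by (intro coprime_mult_rightI coprime_power_rightI) (simp_all add: coprime_commute)
  then have "coprime (w ^ Suc d' * C ^ z) (B ^ y)"
    by (meson coprime_commute coprime_power_rightI)
  then have cop': "coprime (e2 * B ^ y) (e3 * w ^ Suc d' * C ^ z)"
    unfolding mult.assoc using inv[THEN involution_poly(4)]
    by (meson coprime_commute coprime_mult_rightI is_unit_left_imp_coprime)
  have "B ^ y * (w ^ Suc d' * C ^ z) * E dvd B ^ y * ((A ^ x) ^ Suc d' * C ^ z) * A ^ x"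
    using EA wA by (intro mult_dvd_mono dvd_power_same) simp_all
  also have "\<dots> = A ^ (x * Suc d' + x) * B ^ y * C ^ z"
    by (simp add: power_add mult_ac flip: power_mult)
  also have "\<dots> dvd A ^ (x * Suc d' + x + y + z) * B ^ (x * Suc d' + x + y + z) * C ^ (x * Suc d' + x + y + z)"
    by (intro mult_dvd_mono le_imp_power_dvd) simp_all
  finally have "B ^ y * (w ^ Suc d' * C ^ z) * E dvd (A * B * C) ^ (x * Suc d' + x + y + z)"
    by (simp add: power_mult_distrib)
  moreover have "e2 * B ^ y * (e3 * w ^ Suc d' * C ^ z) * E = (e2 * e3) * (B ^ y * (w ^ Suc d' * C ^ z) * E)"
    by (simp only: mult_ac)
  moreover have "is_unit (e2 * e3)"
    using inv[THEN involution_poly(4)] mult_dvd_mono[of e2 1 e3 1] by simp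
  ultimately have dvd: "e2 * B ^ y * (e3 * w ^ Suc d' * C ^ z) * E dvd (A * B * C) ^ (x * Suc d' + x + y + z)"
    using mult_unit_dvd_iff' by metis
  have dB: "degree (e2 * B ^ y) = y * degree B" using inv nonzero by (simp add: degree_involution_mult degree_power_eq)
  have dC: "degree (e3 * w ^ Suc d' * C ^ z) \<ge> z * degree C"
    using inv nonzero \<open>w \<noteq> 0\<close> by (simp add: degree_involution_mult mult.assoc degree_power_eq degree_mult_eq del: power_Suc)
  have "degree (A * B * C) = degree A + degree B + degree C"
    using nonzero by (simp add: degree_mult_eq)
  then have *: "y * degree B < degree A + degree B + degree C"
    "z * degree C < degree A + degree B + degree C"
    using mason_stothers[OF _ cop' dvd] nonzero deg \<open>x < y\<close> dB dC
    by (simp_all add: E_def)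
  interpret r1: quadratic_triple e2 B e3 C e1 A by (rule rotate)
  interpret r2: quadratic_triple e3 C e1 A e2 B by (rule r1.rotate)
  note le = degree_le_max r1.degree_le_max r2.degree_le_max
  \<comment> \<open>Each degree is at most the maximum of the other two, so the largest is attained
    twice. As \<open>3 * degree C\<close> is below the sum of the degrees, \<open>C\<close> is not
    among the largest.\<close>
  have "3 * degree C \<le> z * degree C" using \<open>x > 0\<close> \<open>x < y\<close> \<open>y < z\<close> by (intro mult_le_mono1) simp
  then have AB: "degree A = degree B" and less: "degree C < degree A" using *(2) le by linarith+
  have "y * degree B < 3 * degree B" using * AB less by linarith
  then have "y < 3" by (simp only: mult_less_cancel2)
  then have xy: "y = 2" "x = 1" "d = 0" using \<open>x > 0\<close> \<open>x < y\<close> y by auto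
  have wE: "w * E = e1 * A" using E xy by simp
  have "e1 * (e1 * E) + e2 * B\<^sup>2 + e3 * w ^ Suc d' * C ^ z = (e1 * e1) * E - E"
    unfolding E_def xy by (simp add: algebra_simps)
  then have "e1 * (e1 * E) + e2 * B\<^sup>2 + e3 * w ^ Suc d' * C ^ z = 0" using inv by simp
  moreover have "A = w * (e1 * E)"
  proof -
    have "w * (e1 * E) = e1 * (w * E)" by (simp only: mult_ac)
    also have "\<dots> = (e1 * e1) * A" unfolding wE by (simp only: mult_ac)
    finally show ?thesis using inv by simp
  qed
  moreover have "z \<ge> 3" using z xy by simp
  ultimately show False using exponents_1_2_impossible AB less split by blast
qed

lemma exponents:
  assumes eq: "e1 * (w * A) ^ x + e2 * (w * B) ^ y + e3 * (w * C) ^ z = 0"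
    and w: "w \<noteq> 0" and pos: "x > 0" "y > 0" "z > 0"
    and sA: "degree A < degree B \<Longrightarrow> splits B C A"
    and sB: "degree B < degree C \<Longrightarrow> splits C A B"
    and sC: "degree C < degree A \<Longrightarrow> splits A B C"
  shows "(x, y, z) \<in> {(2, 2, 2), (1, 1, 1), (1, 1, 2), (1, 2, 1), (2, 1, 1)}"
proof -
  interpret s: quadratic_triple e2 B e1 A e3 C by (rule swap)
  interpret r1: quadratic_triple e2 B e3 C e1 A by (rule rotate)
  interpret r1s: quadratic_triple e3 C e2 B e1 A by (rule r1.swap)
  interpret r2: quadratic_triple e3 C e1 A e2 B by (rule r1.rotate)
  interpret r2s: quadratic_triple e1 A e3 C e2 B by (rule r2.swap)
  note le = degree_le_max r1.degree_le_max r2.degree_le_max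
  \<comment> \<open>Since the largest degree is attained twice, a polynomial of smaller degree than
    one of the others has smaller degree than both; this transfers the splitting to the exchanged
    order.\<close>
  have sA': "degree A < degree C \<Longrightarrow> splits C B A"
    by (rule splits_commute[OF sA]) (use le in linarith)
  have sB': "degree B < degree A \<Longrightarrow> splits A C B"
    by (rule splits_commute[OF sB]) (use le in linarith)
  have sC': "degree C < degree B \<Longrightarrow> splits B A C"
    by (rule splits_commute[OF sC]) (use le in linarith)
  have eq_s: "e2 * (w * B) ^ y + e1 * (w * A) ^ x + e3 * (w * C) ^ z = 0"
    and eq_r1: "e2 * (w * B) ^ y + e3 * (w * C) ^ z + e1 * (w * A) ^ x = 0"
    and eq_r1s: "e3 * (w * C) ^ z + e2 * (w * B) ^ y + e1 * (w * A) ^ x = 0"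
    and eq_r2: "e3 * (w * C) ^ z + e1 * (w * A) ^ x + e2 * (w * B) ^ y = 0"
    and eq_r2s: "e1 * (w * A) ^ x + e3 * (w * C) ^ z + e2 * (w * B) ^ y = 0"
    using eq by (simp_all add: add_ac)
  \<comment> \<open>Six cases with two equal exponents, split by the position of the third, and the
    six strict orders; each is settled in the matching permutation of the triple.\<close>
  consider "x = y" "x \<le> z" | "x = y" "z < x" | "y = z" "y \<le> x" | "y = z" "x < y"
    | "x = z" "x \<le> y" | "x = z" "y < x"
    | "x < y" "y < z" | "x < z" "z < y" | "y < x" "x < z" | "y < z" "z < x" | "z < x" "x < y" | "z < y" "y < x"
    by (cases x y rule: linorder_cases; cases y z rule: linorder_cases;
        cases x z rule: linorder_cases; simp)
  then show ?thesis
  proof cases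
    case 1
    then show ?thesis using exponents_eq_le[OF eq[folded 1(1)] w pos(1) 1(2)] by auto
  next
    case 2
    then show ?thesis using not_exponents_less_eq[OF eq[folded 2(1)] w pos(3) 2(2)] by blast
  next
    case 3
    then show ?thesis using r1.exponents_eq_le[OF eq_r1[folded 3(1)] w pos(2) 3(2)] by auto
  next
    case 4
    then show ?thesis using r1.not_exponents_less_eq[OF eq_r1[folded 4(1)] w pos(1) 4(2)] by blast
  next
    case 5
    then show ?thesis using r2.exponents_eq_le[OF eq_r2[folded 5(1)] w pos(1) 5(2)] by auto
  next
    case 6
    then show ?thesis using r2.not_exponents_less_eq[OF eq_r2[folded 6(1)] w pos(2) 6(2)] by blast
  next
    case 7
    then show ?thesis using not_exponents_less_less[OF eq w pos(1) 7 sC] by blast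
  next
    case 8
    then show ?thesis using r2s.not_exponents_less_less[OF eq_r2s w pos(1) 8 sB'] by blast
  next
    case 9
    then show ?thesis using s.not_exponents_less_less[OF eq_s w pos(2) 9 sC'] by blast
  next
    case 10
    then show ?thesis using r1.not_exponents_less_less[OF eq_r1 w pos(2) 10 sA] by blast
  next
    case 11
    then show ?thesis using r2.not_exponents_less_less[OF eq_r2 w pos(3) 11 sB] by blast
  next
    case 12
    then show ?thesis using r1s.not_exponents_less_less[OF eq_r1s w pos(3) 12 sA'] by blast
  qed
qed

end

section \<open>The triple built from \<open>f\<close> and \<open>g\<close>\<close>

text \<open>If the derivative vanished, coprimality would make \<open>f\<close> divide
  \<open>pderiv g\<close> up to a scalar and \<open>g\<close> divide \<open>pderiv f\<close>, so
  each degree would be smaller than the other.\<close>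

lemma degree_sum_squares_pos:
  fixes f g :: "'a::field_char_0 poly"
  assumes "degree f > 0" "degree g > 0" "coprime f g" "c \<noteq> 0"
  shows "degree (f\<^sup>2 + smult c (g\<^sup>2)) > 0"
proof (rule ccontr)
  assume "\<not> ?thesis"
  then have "pderiv (f\<^sup>2 + smult c (g\<^sup>2)) = 0" by (simp add: pderiv_eq_0_iff)
  then have "2 * (f * pderiv f + smult c (g * pderiv g)) = 0"
    by (simp add: pderiv_add pderiv_smult pderiv_mult power2_eq_square smult_add_right algebra_simps)
  then have 0: "f * pderiv f + smult c (g * pderiv g) = 0" by (simp only: mult_eq_0_iff) simp
  have g: "g * smult c (pderiv g) = f * (- pderiv f)" and f: "f * pderiv f = g * smult (- c) (pderiv g)"
    using 0 by (simp_all add: add_eq_0_iff add_eq_0_iff2)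
  have "f dvd smult c (pderiv g)"
    using coprime_dvd_mult_cancel[OF assms(3)] g by (metis dvd_triv_left)
  then have "degree f \<le> degree g - 1"
    using dvd_imp_degree_le[of f "smult c (pderiv g)"] assms by (simp add: pderiv_eq_0_iff degree_pderiv)
  moreover have "g dvd pderiv f"
    using coprime_dvd_mult_cancel[of g f] assms(3) f by (metis dvd_triv_left coprime_commute)
  then have "degree g \<le> degree f - 1"
    using dvd_imp_degree_le[of g "pderiv f"] assms by (simp add: pderiv_eq_0_iff degree_pderiv)
  ultimately show False using assms(1,2) by linarith
qed

lemma coprime_sum_squares:
  fixes f g :: "'a::field_char_0 poly"
  assumes "coprime f g" "c \<noteq> 0"
  shows "coprime (f\<^sup>2 + smult c (g\<^sup>2)) f" "coprime (f\<^sup>2 + smult c (g\<^sup>2)) g"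
proof -
  show "coprime (f\<^sup>2 + smult c (g\<^sup>2)) g"
  proof (rule coprimeI)
    fix d assume d: "d dvd f\<^sup>2 + smult c (g\<^sup>2)" "d dvd g"
    then have "d dvd smult c (g\<^sup>2)" by (intro dvd_smult) (simp add: power2_eq_square)
    then have "d dvd f\<^sup>2" using d(1) dvd_add_left_iff by blast
    moreover have "coprime (f ^ 2) g" using assms(1) by (metis coprime_commute coprime_power_rightI)
    ultimately show "d dvd 1" using d(2) coprime_common_divisor by blast
  qed
  show "coprime (f\<^sup>2 + smult c (g\<^sup>2)) f"
  proof (rule coprimeI)
    fix d assume d: "d dvd f\<^sup>2 + smult c (g\<^sup>2)" "d dvd f"
    then have "d dvd f\<^sup>2" by (simp add: power2_eq_square)
    then have "d dvd smult c (g\<^sup>2)" using d(1) dvd_add_right_iff by blast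
    then have "d dvd g\<^sup>2" using assms(2) by (simp add: dvd_smult_iff)
    moreover have "coprime f (g ^ 2)" using assms(1) by (rule coprime_power_rightI)
    ultimately show "d dvd 1" using d(2) coprime_common_divisor by blast
  qed
qed

lemma smult_half_double: "smult (1 / 2) (2 * p) = (p :: 'a::field_char_0 poly)"
  by (simp add: numeral_poly)

lemma splits_product:
  fixes f g :: "'a::field_char_0 poly"
  shows "splits (f\<^sup>2 + g\<^sup>2) (f\<^sup>2 - g\<^sup>2) (2 * f * g)"
  unfolding splits_def
  by (rule exI[of _ f], rule exI[of _ g], rule exI[of _ 1], rule exI[of _ 1], rule exI[of _ 2],
      rule exI[of _ "-1"]) (simp add: numeral_poly)

text \<open>Factor \<open>f\<^sup>2 - g\<^sup>2\<close> with \<open>P = f + g\<close> and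
  \<open>Q = f - g\<close>.\<close>

lemma splits_difference:
  fixes f g :: "'a::field_char_0 poly"
  shows "splits (2 * f * g) (f\<^sup>2 + g\<^sup>2) (f\<^sup>2 - g\<^sup>2)"
proof -
  have "2 * f * g = smult (1/2) ((f + g)\<^sup>2 - smult 1 ((f - g)\<^sup>2))"
    by (rule trans[OF smult_half_double[symmetric]], rule arg_cong[of _ _ "smult (1/2)"])
      (simp add: power2_eq_square algebra_simps)
  moreover have "f\<^sup>2 + g\<^sup>2 = smult (1/2) ((f + g)\<^sup>2 + smult 1 ((f - g)\<^sup>2))"
    by (rule trans[OF smult_half_double[symmetric]], rule arg_cong[of _ _ "smult (1/2)"])
      (simp add: power2_eq_square algebra_simps)
  moreover have "f\<^sup>2 - g\<^sup>2 = smult 1 ((f + g) * (f - g))" by (simp add: power2_eq_square algebra_simps)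
  ultimately show ?thesis unfolding splits_def using mult_1 by metis
qed

text \<open>When \<open>f\<^sup>2 + g\<^sup>2\<close> has smaller degree than \<open>f\<^sup>2 - g\<^sup>2\<close>, the quotient of the leading
  coefficients of \<open>f\<close> and \<open>g\<close> is a square root of \<open>-1\<close>, so no field extension is needed.\<close>

lemma splits_sum:
  fixes f g :: "'a::field_char_0 poly"
  assumes "degree (f\<^sup>2 + g\<^sup>2) < degree (f\<^sup>2 - g\<^sup>2)" "f \<noteq> 0" "g \<noteq> 0"
  shows "splits (f\<^sup>2 - g\<^sup>2) (2 * f * g) (f\<^sup>2 + g\<^sup>2)"
proof -
  define n where "n = degree g"
  \<comment> \<open>With unequal degrees the larger square would dominate both the sum and the
    difference, giving them equal degrees.\<close>
  have fg: "degree f = degree g"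
  proof (rule ccontr)
    assume "degree f \<noteq> degree g"
    then consider "degree (f\<^sup>2) < degree (g\<^sup>2)" | "degree (g\<^sup>2) < degree (f\<^sup>2)"
      using assms by (fastforce simp: degree_power_eq)
    then have "degree (f\<^sup>2 + g\<^sup>2) = degree (f\<^sup>2 - g\<^sup>2)"
    proof cases
      case 1
      then show ?thesis using degree_add_eq_right[of "f\<^sup>2" "g\<^sup>2"] degree_add_eq_right[of "f\<^sup>2" "-(g\<^sup>2)"] by simp
    next
      case 2
      then show ?thesis using degree_add_eq_left[of "g\<^sup>2" "f\<^sup>2"] degree_add_eq_left[of "-(g\<^sup>2)" "f\<^sup>2"] by simp
    qed
    then show False using assms by simp
  qed
  have "degree (f\<^sup>2 - g\<^sup>2) \<le> 2 * n"
    using assms fg by (intro degree_diff_le) (simp_all add: degree_power_eq n_def)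
  \<comment> \<open>The drop in degree means that the leading terms of the two squares cancel in the
    sum.\<close>
  then have "coeff (f\<^sup>2 + g\<^sup>2) (2 * n) = 0" using assms by (intro coeff_eq_0) simp
  moreover have "coeff (f\<^sup>2) (2 * n) = (lead_coeff f)\<^sup>2" "coeff (g\<^sup>2) (2 * n) = (lead_coeff g)\<^sup>2"
    using lead_coeff_power[of f 2] lead_coeff_power[of g 2] assms fg by (simp_all add: degree_power_eq n_def)
  ultimately have l: "(lead_coeff f)\<^sup>2 + (lead_coeff g)\<^sup>2 = 0" by simp
  define i where "i = lead_coeff f / lead_coeff g"
  have "i * i + 1 = ((lead_coeff f)\<^sup>2 + (lead_coeff g)\<^sup>2) / (lead_coeff g)\<^sup>2"
    using assms by (simp add: i_def power2_eq_square add_divide_distrib)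
  then have ii: "i * i = - 1" unfolding l by (simp add: add_eq_0_iff2)
  then have i0: "i \<noteq> 0" by auto
  have I: "[:i:] * [:i:] = - 1" using ii by (simp add: one_pCons)
  \<comment> \<open>\<open>P\<close> and \<open>Q\<close> are the two factors of
    \<open>f\<^sup>2 + g\<^sup>2\<close> over the square root \<open>i\<close> of -1.\<close>
  define P Q where "P = f + [:i:] * g" and "Q = f - [:i:] * g"
  have sq: "([:i:] * g) * ([:i:] * g) = - (g * g)"
  proof -
    have "([:i:] * g) * ([:i:] * g) = ([:i:] * [:i:]) * (g * g)" by (simp only: mult_ac)
    then show ?thesis unfolding I by simp
  qed
  have "f\<^sup>2 - g\<^sup>2 = smult (1/2) (P\<^sup>2 - smult (-1) (Q\<^sup>2))"
  proof -
    have "P\<^sup>2 - smult (-1) (Q\<^sup>2) = 2 * (f * f + ([:i:] * g) * ([:i:] * g))"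
      unfolding P_def Q_def by (simp add: power2_eq_square algebra_simps)
    also have "\<dots> = 2 * (f\<^sup>2 - g\<^sup>2)" unfolding sq by (simp add: power2_eq_square)
    finally show ?thesis by (simp only: smult_half_double)
  qed
  moreover have "2 * f * g = smult (1/(2*i)) (P\<^sup>2 + smult (-1) (Q\<^sup>2))"
  proof -
    have "P\<^sup>2 + smult (-1) (Q\<^sup>2) = smult (2 * i) (2 * f * g)"
      unfolding P_def Q_def by (simp add: power2_eq_square algebra_simps numeral_poly)
    then show ?thesis using i0 by simp
  qed
  moreover have "f\<^sup>2 + g\<^sup>2 = smult 1 (P * Q)"
  proof -
    have "P * Q = f * f - ([:i:] * g) * ([:i:] * g)"
      unfolding P_def Q_def by (simp add: algebra_simps)
    then show ?thesis unfolding sq by (simp add: power2_eq_square)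
  qed
  moreover have "(-1) * (-1) = (1 :: 'a)" by simp
  ultimately show ?thesis unfolding splits_def by metis
qed

lemma pythagorean_quadratic_triple:
  fixes f g :: "'a::field_char_0 poly"
  assumes "degree f > 0" "degree g > 0" "coprime f g"
  shows "quadratic_triple 1 (f\<^sup>2 - g\<^sup>2) 1 (2 * f * g) (-1) (f\<^sup>2 + g\<^sup>2)"
proof
  have A: "coprime (f\<^sup>2 - g\<^sup>2) f" "coprime (f\<^sup>2 - g\<^sup>2) g"
    using coprime_sum_squares[OF assms(3), of "-1"] by simp_all
  have C: "coprime (f\<^sup>2 + g\<^sup>2) f" "coprime (f\<^sup>2 + g\<^sup>2) g"
    using coprime_sum_squares[OF assms(3), of 1] by simp_all
  have u: "is_unit (2 :: 'a poly)" by (simp add: numeral_poly is_unit_poly_iff dvd_field_iff)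
  then have u2: "coprime p 2" for p :: "'a poly" by (rule is_unit_right_imp_coprime)
  show "coprime (f\<^sup>2 - g\<^sup>2) (2 * f * g)" using A u2 by (intro coprime_mult_rightI)
  have "coprime (f\<^sup>2 + g\<^sup>2) (2 * f * g)" using C u2 by (intro coprime_mult_rightI)
  then show "coprime (2 * f * g) (f\<^sup>2 + g\<^sup>2)" by (simp add: coprime_commute)
  show "coprime (f\<^sup>2 - g\<^sup>2) (f\<^sup>2 + g\<^sup>2)"
  proof (rule coprimeI)
    fix d assume d: "d dvd f\<^sup>2 - g\<^sup>2" "d dvd f\<^sup>2 + g\<^sup>2"
    then have "d dvd (f\<^sup>2 - g\<^sup>2) + (f\<^sup>2 + g\<^sup>2)" by (rule dvd_add)
    also have "(f\<^sup>2 - g\<^sup>2) + (f\<^sup>2 + g\<^sup>2) = 2 * (f * f)" by (simp add: power2_eq_square)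
    finally have "d dvd 2 * (f * f)" .
    moreover have "coprime (f\<^sup>2 + g\<^sup>2) (2 * (f * f))" using C u2 by (intro coprime_mult_rightI)
    ultimately show "d dvd 1" using d(2) coprime_common_divisor by blast
  qed
  show "degree (f\<^sup>2 - g\<^sup>2) > 0" using degree_sum_squares_pos[OF assms, of "-1"] by simp
  show "degree (f\<^sup>2 + g\<^sup>2) > 0" using degree_sum_squares_pos[OF assms, of 1] by simp
  have "f \<noteq> 0" "g \<noteq> 0" "degree (2 :: 'a poly) = 0" using assms by (auto simp: numeral_poly)
  then show "degree (2 * f * g) > 0" using assms by (simp add: degree_mult_eq)
  show "1 * (f\<^sup>2 - g\<^sup>2)\<^sup>2 + 1 * (2 * f * g)\<^sup>2 + (-1) * (f\<^sup>2 + g\<^sup>2)\<^sup>2 = 0"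
    by (simp add: power2_eq_square algebra_simps)
qed simp_all

section \<open>The equation itself: excluding spurious exponents and characterizing (2, 1,
  1)\<close>

theorem theorem1p2:
  fixes f g w :: "'a::field_char_0 poly"
  assumes "degree f > 0" and "degree g > 0"
    and "coprime f g"
    and "w \<noteq> 0"
  shows "(2, 2, 2) \<in> solutions f g w
    \<and> solutions f g w \<subseteq> {(2, 2, 2), (2, 1, 1)}
    \<and> ((2, 1, 1) \<in> solutions f g w \<longleftrightarrow>
         (\<exists>c s. c \<noteq> 0 \<and> w = [:c:] \<and> s\<^sup>2 = c \<and>
            (f = - g + [:1 / s:] \<or> f = - g - [:1 / s:])))"
proof -
  define A B C where "A = f\<^sup>2 - g\<^sup>2" and "B = 2 * f * g" and "C = f\<^sup>2 + g\<^sup>2"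
  interpret quadratic_triple 1 A 1 B "-1" C
    unfolding A_def B_def C_def using assms(1-3) by (rule pythagorean_quadratic_triple)
  have sol: "(x, y, z) \<in> solutions f g w \<longleftrightarrow>
      x > 0 \<and> y > 0 \<and> z > 0 \<and> (w * A) ^ x + (w * B) ^ y = (w * C) ^ z" for x y z
    unfolding solutions_def A_def B_def C_def by (simp add: mult_ac)
  have f0: "f \<noteq> 0" and g0: "g \<noteq> 0" using assms by auto
  have fg: "f \<noteq> g" using assms by (auto simp: is_unit_poly_iff)
  have one: "(2, 2, 2) \<in> solutions f g w"
  proof -
    have "(w * A)\<^sup>2 + (w * B)\<^sup>2 = (w * C)\<^sup>2"
      unfolding A_def B_def C_def by (simp add: power2_eq_square algebra_simps)
    then show ?thesis unfolding sol by simp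
  qed
  have two: "solutions f g w \<subseteq> {(2, 2, 2), (2, 1, 1)}"
  proof
    fix t assume "t \<in> solutions f g w"
    moreover obtain x y z where t: "t = (x, y, z)" by (cases t)
    ultimately have "(x, y, z) \<in> solutions f g w" by simp
    then have pos: "x > 0" "y > 0" "z > 0" and eq: "(w * A) ^ x + (w * B) ^ y = (w * C) ^ z"
      unfolding sol by auto
    have "1 * (w * A) ^ x + 1 * (w * B) ^ y + (-1) * (w * C) ^ z = 0" using eq by simp
    then have "(x, y, z) \<in> {(2, 2, 2), (1, 1, 1), (1, 1, 2), (1, 2, 1), (2, 1, 1)}"
      using assms(4) pos
    proof (rule exponents)
      show "splits B C A" unfolding A_def B_def C_def by (rule splits_difference)
      show "splits C A B" unfolding A_def B_def C_def by (rule splits_product)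
      show "splits A B C" if "degree C < degree A"
        using that f0 g0 unfolding A_def B_def C_def by (intro splits_sum)
    qed
    moreover have "(x, y, z) \<noteq> (1, 1, 1)"
    proof
      assume "(x, y, z) = (1, 1, 1)"
      then have "w * (A + B) = w * C" using eq by (simp add: distrib_left)
      then have "A + B - C = 0" using assms(4) by simp
      moreover have "A + B - C = 2 * g * (f - g)"
        unfolding A_def B_def C_def by (simp add: power2_eq_square algebra_simps)
      ultimately show False using g0 fg by simp
    qed
    moreover have "(x, y, z) \<noteq> (1, 1, 2)"
    proof
      assume "(x, y, z) = (1, 1, 2)"
      then have "w * (A + B) = w * (w * C * C)" using eq by (simp add: distrib_left power2_eq_square mult_ac)
      then have "A + B = w * C * C" using assms(4) by simp
      \<comment> \<open>The square of \<open>A + B\<close> is \<open>C * C + 2 * A * B\<close>, so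
        \<open>C\<close> would divide \<open>2 * A * B\<close> and, by coprimality, the constant
        2.\<close>
      then have "C dvd (A + B) * (A + B)" by simp
      also have "(A + B) * (A + B) = C * C + A * (2 * B)"
        unfolding A_def B_def C_def by (simp add: power2_eq_square algebra_simps)
      finally have "C dvd A * (2 * B)" using dvd_add_right_iff[of C "C * C"] by simp
      moreover have "coprime C A" "coprime C B" using cop by (simp_all add: coprime_commute)
      ultimately have "C dvd B * 2" using coprime_dvd_mult_cancel by (metis mult.commute)
      then have "C dvd 2" using coprime_dvd_mult_cancel \<open>coprime C B\<close> by blast
      then show False using deg(3) dvd_imp_degree_le[of C 2] by (simp add: numeral_poly)
    qed
    moreover have "(x, y, z) \<noteq> (1, 2, 1)"
    proof
      assume "(x, y, z) = (1, 2, 1)"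
      then have "w * (A + w * B * B) = w * C" using eq by (simp add: distrib_left power2_eq_square mult_ac)
      then have "A + w * B * B = C" using assms(4) by simp
      \<comment> \<open>As \<open>C - A\<close> equals \<open>2 * g * g\<close>, cancelling this
        factor makes \<open>f\<close> a unit.\<close>
      then have "w * B * B = C - A" by (simp add: algebra_simps)
      also have "\<dots> = 2 * g * g" unfolding A_def C_def by (simp add: power2_eq_square)
      finally have "(2 * g * g) * (2 * w * f * f) = (2 * g * g) * 1" unfolding B_def by (simp add: mult_ac)
      then have "2 * w * f * f = 1" using g0 by (metis mult_cancel_left mult_eq_0_iff zero_neq_numeral)
      then have "f dvd 1" by (metis dvd_triv_right)
      then show False using assms(1) by (auto simp: is_unit_poly_iff)
    qed
    ultimately show "t \<in> {(2, 2, 2), (2, 1, 1)}" unfolding t by blast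
  qed
  have three: "(2, 1, 1) \<in> solutions f g w \<longleftrightarrow> w * ((f + g) * (f + g)) = 1"
  proof -
    \<comment> \<open>Since \<open>C - B\<close> is the square of \<open>f - g\<close> and
      \<open>A\<close> is \<open>(f - g) * (f + g)\<close>, the equation factors.\<close>
    have "(w * A)\<^sup>2 + w * B - w * C = (w * ((f - g) * (f - g))) * (w * ((f + g) * (f + g)) - 1)"
      unfolding A_def B_def C_def by (simp add: power2_eq_square algebra_simps)
    moreover have "w * ((f - g) * (f - g)) \<noteq> 0" using assms(4) fg by simp
    ultimately have "(w * A)\<^sup>2 + w * B - w * C = 0 \<longleftrightarrow> w * ((f + g) * (f + g)) - 1 = 0" by simp
    then show ?thesis unfolding sol by simp
  qed
  have four: "w * ((f + g) * (f + g)) = 1 \<longleftrightarrow>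
         (\<exists>c s. c \<noteq> 0 \<and> w = [:c:] \<and> s\<^sup>2 = c \<and>
            (f = - g + [:1 / s:] \<or> f = - g - [:1 / s:]))" (is "?L \<longleftrightarrow> ?R")
  proof
    assume L: ?L
    then have "f + g dvd 1" "w dvd 1" by (metis dvd_triv_left dvd_triv_right mult.assoc)+
    then obtain c d where cd: "w = [:c:]" "f + g = [:d:]" by (auto simp: is_unit_poly_iff)
    then have "c * (d * d) = 1" using L by (simp add: one_pCons mult_ac)
    moreover from this have "d \<noteq> 0" "c \<noteq> 0" by auto
    \<comment> \<open>The required square root of \<open>c\<close> is \<open>1 / d\<close>, where
      \<open>d\<close> is the constant value of \<open>f + g\<close>.\<close>
    ultimately have "(1 / d)\<^sup>2 = c" by (simp add: power2_eq_square field_simps)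
    moreover have "f = - g + [:1 / (1 / d):]" using cd(2) by (simp add: algebra_simps)
    ultimately show ?R using cd(1) \<open>c \<noteq> 0\<close> by blast
  next
    assume ?R
    then obtain c s where cs: "c \<noteq> 0" "w = [:c:]" "s\<^sup>2 = c"
      "f = - g + [:1 / s:] \<or> f = - g - [:1 / s:]" by blast
    then have "s \<noteq> 0" by auto
    have "f + g = [:1 / s:] \<or> f + g = - [:1 / s:]" using cs(4) by auto
    then have "(f + g) * (f + g) = [:1 / s * (1 / s):]" by auto
    then show ?L using cs(2,3) \<open>s \<noteq> 0\<close> by (auto simp: power2_eq_square one_pCons)
  qed
  show ?thesis using one two three four by simp
qed

end
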